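(* Let $G$ be a finite group. The following are equivalent: (1) $o(a)<4$ for every $a\in G$; (2) $\mathcal{G}^*_e(G)$ has no cycle; (3) $\mathcal{G}^*_e(G)$ is bipartite; (4) $\mathcal{G}^*_e(G)$ is a forest.
   Context: For a group $G$, the enhanced power graph $\mathcal{G}_e(G)$ is the simple undirected graph with vertex set $G$ in which two distinct vertices $x,y$ are adjacent if there exists $z\in G$ with $x=z^m$ and $y=z^n$ for some $m,n\in\mathbb{N}$. The deleted enhanced power graph $\mathcal{G}^*_e(G)$ is the induced subgraph of $\mathcal{G}_e(G)$ on $G\setminus\{e\}$, where $e$ is the identity. $o(a)$ is the order of $a$. *)

theory Defs
  imports "HOL-Algebra.Multiplicative_Group" "Graph_Theory.Graph_Theory"
begin

text \<open>
  A simple undirected graph is represented, as in the \<^locale>\<open>graph\<close> locale, by a loop-free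
  symmetric digraph without parallel arcs: the edge between \<open>x\<close> and \<open>y\<close> is the pair of arcs
  \<open>(x, y)\<close>, \<open>(y, x)\<close>.
\<close>

definition enhanced_power_graph :: "('a, 'm) monoid_scheme \<Rightarrow> ('a, 'a \<times> 'a) pre_digraph" where
  "enhanced_power_graph G = with_proj
    \<lparr> pverts = carrier G,
      parcs = {(x, y). x \<in> carrier G \<and> y \<in> carrier G \<and> x \<noteq> y \<and>
        (\<exists>z\<in>carrier G. \<exists>(m::nat) (n::nat). x = z [^]\<^bsub>G\<^esub> m \<and> y = z [^]\<^bsub>G\<^esub> n)} \<rparr>"

definition deleted_enhanced_power_graph :: "('a, 'm) monoid_scheme \<Rightarrow> ('a, 'a \<times> 'a) pre_digraph" where
  "deleted_enhanced_power_graph G = enhanced_power_graph G \<restriction> (carrier G - {\<one>\<^bsub>G\<^esub>})"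

text \<open>
  \<^const>\<open>pre_digraph.cycle\<close> counts the closed walk \<open>x, y, x\<close> along the two arcs of a single
  undirected edge as a cycle, so every graph with an edge would fail the library's
  \<^const>\<open>forest\<close>. A cycle of a simple undirected graph has at least three vertices.
\<close>

definition ugraph_cycle :: "('a, 'b) pre_digraph \<Rightarrow> 'b awalk \<Rightarrow> bool" where
  "ugraph_cycle H p \<longleftrightarrow> pre_digraph.cycle H p \<and> 3 \<le> length p"

definition ugraph_acyclic :: "('a, 'b) pre_digraph \<Rightarrow> bool" where
  "ugraph_acyclic H \<longleftrightarrow> (\<nexists>p. ugraph_cycle H p)"

definition ugraph_tree :: "('a, 'b) pre_digraph \<Rightarrow> bool" where
  "ugraph_tree H \<longleftrightarrow> connected H \<and> ugraph_acyclic H"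

text \<open>
  A forest is a graph all of whose connected components are trees. In a symmetric digraph the
  strongly connected components are the connected components. The graph without vertices is
  a forest.
\<close>

definition ugraph_forest :: "('a, 'b) pre_digraph \<Rightarrow> bool" where
  "ugraph_forest H \<longleftrightarrow> (\<forall>C\<in>pre_digraph.sccs H. ugraph_tree C)"

text \<open>The parts of a bipartition may be empty, so edgeless graphs are bipartite.\<close>

definition bipartite :: "('a, 'b) pre_digraph \<Rightarrow> bool" where
  "bipartite H \<longleftrightarrow> (\<exists>U V. verts H = U \<union> V \<and> U \<inter> V = {} \<and> arcs_ends H \<subseteq> U \<times> V \<union> V \<times> U)"

lemma graph_enhanced_power_graph:
  assumes "finite (carrier G)"
  shows "graph (enhanced_power_graph G)"
proof -
  let ?P = "\<lparr> pverts = carrier G,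
      parcs = {(x, y). x \<in> carrier G \<and> y \<in> carrier G \<and> x \<noteq> y \<and>
        (\<exists>z\<in>carrier G. \<exists>(m::nat) (n::nat). x = z [^]\<^bsub>G\<^esub> m \<and> y = z [^]\<^bsub>G\<^esub> n)} \<rparr>"
  have "finite (parcs ?P)"
    by (rule finite_subset[OF _ finite_cartesian_product[OF assms assms]]) auto
  then have "pair_graph ?P"
    using assms by unfold_locales (auto simp: symmetric_def sym_def)
  then interpret pair_graph ?P .
  show ?thesis
    unfolding enhanced_power_graph_def by (rule graph_axioms)
qed

lemma graph_deleted_enhanced_power_graph:
  assumes "finite (carrier G)"
  shows "graph (deleted_enhanced_power_graph G)"
proof -
  interpret graph "enhanced_power_graph G"
    using assms by (rule graph_enhanced_power_graph)
  have ind: "induced_subgraph (deleted_enhanced_power_graph G) (enhanced_power_graph G)"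
    unfolding deleted_enhanced_power_graph_def
    by (rule induced_induce) (auto simp: enhanced_power_graph_def)
  have "digraph (deleted_enhanced_power_graph G)"
    using ind by (rule digraphI_induced)
  moreover have "sym_digraph (deleted_enhanced_power_graph G)"
    using ind by (rule induced_graph_imp_graph)
  ultimately show ?thesis
    by (simp add: graph_def pseudo_graph_def digraph_def)
qed

end

theory Submission
  imports Defs
begin

text \<open>
  If \<open>o(a) \<ge> 4\<close>, then \<open>a\<close>, \<open>a\<^sup>2\<close>, \<open>a\<^sup>3\<close> are distinct and different from the identity, so they form a
  triangle, which excludes bipartiteness and acyclicity. If all orders are below 4, then the only
  non-identity elements of a cyclic subgroup are a generator and its inverse, so every vertex
  has at most one neighbour.
\<close>

text \<open>Symmetrizing only adds arcs, so reachability survives. This links members of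
  \<open>sccs\<close> to the notion of connectedness required of a tree.\<close>

lemma (in wf_digraph) strongly_connected_imp_connected:
  assumes "strongly_connected G"
  shows "connected G"
  using assms unfolding connected_def strongly_connected_def
  by (auto intro: reachable_mk_symmetricI)

lemma (in wf_digraph) ugraph_acyclic_subgraph:
  assumes "subgraph H G" and "ugraph_acyclic G"
  shows "ugraph_acyclic H"
  using assms by (auto simp: ugraph_acyclic_def ugraph_cycle_def intro: subgraph_cycle)

text \<open>A cycle never leaves its component, and components inherit acyclicity as
  subgraphs.\<close>

lemma (in sym_digraph) ugraph_forest_iff_acyclic: "ugraph_forest G \<longleftrightarrow> ugraph_acyclic G"
proof
  assume acyclic: "ugraph_acyclic G"
  show "ugraph_forest G"
    unfolding ugraph_forest_def ugraph_tree_def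
  proof (intro ballI conjI)
    fix C assume "C \<in> sccs"
    then have ind: "induced_subgraph C G" and sc: "strongly_connected C"
      by (auto simp: sccs_def)
    from ind interpret C: wf_digraph C by (rule wf_digraphI_induced)
    show "connected C" using sc by (rule C.strongly_connected_imp_connected)
    show "ugraph_acyclic C"
      using induced_imp_subgraph[OF ind] acyclic by (rule ugraph_acyclic_subgraph)
  qed
next
  assume forest: "ugraph_forest G"
  show "ugraph_acyclic G"
    unfolding ugraph_acyclic_def
  proof
    assume "\<exists>p. ugraph_cycle G p"
    then obtain u p where p: "awalk u p u" "distinct (tl (awalk_verts u p))" "p \<noteq> []" "3 \<le> length p"
      by (auto simp: ugraph_cycle_def cycle_def)
    \<comment> \<open>By symmetry, the vertices reachable from \<open>u\<close> induce a strongly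
      connected component; it contains every vertex of the walk \<open>p\<close>.\<close>
    let ?C = "G \<restriction> {v. u \<rightarrow>\<^sup>* v}"
    have "?C \<in> sccs"
      using p(1) by (intro induce_reachable_is_in_sccs) auto
    with forest have "ugraph_acyclic ?C"
      by (auto simp: ugraph_forest_def ugraph_tree_def)
    moreover have "pre_digraph.awalk ?C u p u"
      using p(1) by (intro awalk_induce) (auto intro: awalk_verts_reachable_from)
    then have "ugraph_cycle ?C p"
      using p by (auto simp: ugraph_cycle_def pre_digraph.cycle_def awalk_verts_induce)
    ultimately show False by (auto simp: ugraph_acyclic_def)
  qed
qed

lemma (in wf_digraph) triangle_not_ugraph_acyclic:
  assumes "u \<rightarrow> v" "v \<rightarrow> w" "w \<rightarrow> u" and "distinct [u, v, w]"
  shows "\<not> ugraph_acyclic G"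
proof -
  from assms(1-3) obtain e f g where
    "e \<in> arcs G" "tail G e = u" "head G e = v"
    "f \<in> arcs G" "tail G f = v" "head G f = w"
    "g \<in> arcs G" "tail G g = w" "head G g = u"
    by (metis reachableE)
  then have "awalk u [e, f, g] u" "distinct (tl (awalk_verts u [e, f, g]))"
    using assms(4) by (auto simp: awalk_Cons_iff awalk_Nil_iff)
  then have "ugraph_cycle G [e, f, g]"
    by (auto simp: ugraph_cycle_def cycle_def)
  then show ?thesis by (auto simp: ugraph_acyclic_def)
qed

text \<open>Two of the three vertices would share a part, yet arcs only join different
  parts.\<close>

lemma triangle_not_bipartite:
  assumes "u \<rightarrow>\<^bsub>H\<^esub> v" "v \<rightarrow>\<^bsub>H\<^esub> w" "w \<rightarrow>\<^bsub>H\<^esub> u"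
  shows "\<not> bipartite H"
  using assms unfolding bipartite_def by blast

text \<open>On a walk of length at least three, some vertex is preceded and followed by neighbours;
  uniqueness identifies these two, so a vertex repeats.\<close>

lemma (in sym_digraph) unique_neighbour_imp_ugraph_acyclic:
  assumes "\<And>x y z. x \<rightarrow> y \<Longrightarrow> x \<rightarrow> z \<Longrightarrow> y = z"
  shows "ugraph_acyclic G"
  unfolding ugraph_acyclic_def
proof
  assume "\<exists>p. ugraph_cycle G p"
  then obtain u p where p: "awalk u p u" "distinct (tl (awalk_verts u p))" "3 \<le> length p"
    by (auto simp: ugraph_cycle_def cycle_def)
  from p(3) obtain e f g q where [simp]: "p = e # f # g # q"
    by (auto simp: numeral_3_eq_3 Suc_le_length_iff)
  have "head G e \<rightarrow> head G f" "head G f \<rightarrow> head G g"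
    using p(1) by (auto simp: awalk_Cons_iff arcs_ends_conv)
  with sym_arcs have "head G e = head G g"
    by (blast intro: assms arcs_ends_symmetric)
  \<comment> \<open>Even for empty \<open>q\<close> this occurrence lies after those of
    \<open>head G e\<close> and \<open>head G f\<close>, so the supposedly distinct vertex list
    contains \<open>head G e\<close> twice.\<close>
  moreover have "head G g \<in> set (awalk_verts (head G g) q)"
    using p(1) by (auto simp: awalk_Cons_iff intro: hd_in_awalk_verts)
  ultimately show False using p(1,2) by (auto simp: awalk_Cons_iff)
qed

lemma (in graph) unique_neighbour_imp_bipartite:
  assumes unique: "\<And>x y z. x \<rightarrow> y \<Longrightarrow> x \<rightarrow> z \<Longrightarrow> y = z"
  shows "bipartite G"
proof -
  \<comment> \<open>The components are single vertices and single edges; \<open>?U\<close> chooses one vertex of each.\<close>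
  let ?U = "{x \<in> verts G. x = (SOME y. y = x \<or> x \<rightarrow> y)}"
  have edge: "x \<in> ?U \<longleftrightarrow> y \<notin> ?U" if xy: "x \<rightarrow> y" for x y
  proof -
    have yx: "y \<rightarrow> x" using xy sym_arcs by (rule arcs_ends_symmetric[rotated])
    \<comment> \<open>The choices made at \<open>x\<close> and at \<open>y\<close> range over the
      same predicate, so they agree and select exactly one end of the edge.\<close>
    have "(\<lambda>z. z = x \<or> x \<rightarrow> z) = (\<lambda>z. z = x \<or> z = y)"
      using xy unique by blast
    moreover have "(\<lambda>z. z = y \<or> y \<rightarrow> z) = (\<lambda>z. z = x \<or> z = y)"
      using yx unique by blast
    moreover have "(SOME z. z = x \<or> z = y) \<in> {x, y}"
      by (metis (mono_tags, lifting) insertCI insertE singletonD someI)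
    moreover have "x \<noteq> y" using xy adj_not_same by blast
    moreover have "x \<in> verts G" "y \<in> verts G" using xy by auto
    ultimately show ?thesis by auto
  qed
  have "arcs_ends G \<subseteq> ?U \<times> (verts G - ?U) \<union> (verts G - ?U) \<times> ?U"
  proof
    fix a assume a: "a \<in> arcs_ends G"
    obtain x y where [simp]: "a = (x, y)" by (cases a)
    have "x \<in> verts G" "y \<in> verts G" using a by auto
    with edge[of x y] a show "a \<in> ?U \<times> (verts G - ?U) \<union> (verts G - ?U) \<times> ?U"
      by (simp only: \<open>a = (x, y)\<close>) blast
  qed
  then show ?thesis
    unfolding bipartite_def
    by (intro exI[of _ ?U] exI[of _ "verts G - ?U"]) blast
qed

lemma dominates_deleted_enhanced_power_graph_iff:
  "x \<rightarrow>\<^bsub>deleted_enhanced_power_graph G\<^esub> y \<longleftrightarrow>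
    x \<in> carrier G - {\<one>\<^bsub>G\<^esub>} \<and> y \<in> carrier G - {\<one>\<^bsub>G\<^esub>} \<and> x \<noteq> y \<and>
    (\<exists>z\<in>carrier G. \<exists>(m::nat) (n::nat). x = z [^]\<^bsub>G\<^esub> m \<and> y = z [^]\<^bsub>G\<^esub> n)"
  by (auto simp: deleted_enhanced_power_graph_def enhanced_power_graph_def arcs_ends_conv
      intro!: rev_image_eqI)

text \<open>The exponents have distinct nonzero residues modulo \<open>ord z\<close>. Orders 1 and 2
  have too few residues; for order 3 they are 1 and 2, with sum divisible by 3.\<close>

lemma (in group) nontrivial_powers_of_ord_less_4:
  fixes m n :: nat
  assumes z: "z \<in> carrier G" and ord: "0 < ord z" "ord z < 4"
    and "z [^] m \<noteq> \<one>" "z [^] n \<noteq> \<one>" "z [^] m \<noteq> z [^] n"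
  shows "z [^] n = inv (z [^] m)"
proof -
  have m: "\<not> ord z dvd m" and n: "\<not> ord z dvd n"
    using assms by (auto simp: pow_eq_id)
  have "m mod ord z \<noteq> n mod ord z"
  proof
    assume "m mod ord z = n mod ord z"
    then have "int (ord z) dvd int n - int m"
      by (metis mod_eq_dvd_iff of_nat_mod)
    then have "z [^] int m = z [^] int n"
      using z by (simp add: int_pow_eq)
    with assms(6) show False by (simp add: int_pow_int)
  qed
  moreover have "ord z = 1 \<or> ord z = 2 \<or> ord z = 3"
    using ord by auto
  ultimately have "ord z dvd n + m"
    using m n by (elim disjE; simp; presburger)
  then have "z [^] n \<otimes> z [^] m = \<one>"
    using z by (simp add: nat_pow_mult pow_eq_id)
  then show ?thesis
    using z by (metis inv_equality nat_pow_closed)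
qed

theorem theorem5p4:
  fixes G :: "('a, 'm) monoid_scheme"
  assumes "group G" and "finite (carrier G)"
  shows "((\<forall>a\<in>carrier G. group.ord G a < 4) \<longleftrightarrow> ugraph_acyclic (deleted_enhanced_power_graph G)) \<and>
         (ugraph_acyclic (deleted_enhanced_power_graph G) \<longleftrightarrow> bipartite (deleted_enhanced_power_graph G)) \<and>
         (bipartite (deleted_enhanced_power_graph G) \<longleftrightarrow> ugraph_forest (deleted_enhanced_power_graph G))"
proof -
  interpret group G by fact
  let ?H = "deleted_enhanced_power_graph G"
  interpret H: graph ?H
    using assms(2) by (rule graph_deleted_enhanced_power_graph)
  have small: "ugraph_acyclic ?H \<and> bipartite ?H" if ord: "\<forall>a\<in>carrier G. ord a < 4"
  proof -
    \<comment> \<open>The only possible neighbour of \<open>x\<close> is its inverse. Finiteness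
      gives positive orders, excluding the value 0 that stands for infinite order.\<close>
    have "y = inv\<^bsub>G\<^esub> x" if "x \<rightarrow>\<^bsub>?H\<^esub> y" for x y
      using that ord ord_ge_1[OF assms(2)]
      by (force simp: dominates_deleted_enhanced_power_graph_iff
          intro: nontrivial_powers_of_ord_less_4)
    then have "y = z" if "x \<rightarrow>\<^bsub>?H\<^esub> y" "x \<rightarrow>\<^bsub>?H\<^esub> z" for x y z
      using that by metis
    then show ?thesis
      using H.unique_neighbour_imp_ugraph_acyclic H.unique_neighbour_imp_bipartite by blast
  qed
  have large: "\<not> ugraph_acyclic ?H \<and> \<not> bipartite ?H" if a: "a \<in> carrier G" and ord: "4 \<le> ord a"
    for a
  proof -
    have inj: "a [^]\<^bsub>G\<^esub> i \<noteq> a [^]\<^bsub>G\<^esub> j" if "i \<noteq> j" "i < 4" "j < 4" for i j :: nat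
    proof -
      have "i \<in> {0..ord a - 1}" "j \<in> {0..ord a - 1}" using that ord by simp_all
      with that(1) show ?thesis using inj_onD[OF ord_inj[OF a], of i j] by blast
    qed
    have edge: "(a [^]\<^bsub>G\<^esub> i) \<rightarrow>\<^bsub>?H\<^esub> (a [^]\<^bsub>G\<^esub> j)" if "i \<in> {1, 2, 3}" "j \<in> {1, 2, 3}" "i \<noteq> j"
      for i j :: nat
    proof -
      have "a [^]\<^bsub>G\<^esub> i \<noteq> a [^]\<^bsub>G\<^esub> j"
        using that by (intro inj) auto
      \<comment> \<open>Exponent 0 represents the identity, so both powers remain vertices after the
        deletion; \<open>a\<close> itself is their common generator.\<close>
      moreover have "a [^]\<^bsub>G\<^esub> i \<noteq> a [^]\<^bsub>G\<^esub> (0::nat)" "a [^]\<^bsub>G\<^esub> j \<noteq> a [^]\<^bsub>G\<^esub> (0::nat)"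
        using that by (intro inj; force)+
      ultimately show ?thesis
        using a unfolding dominates_deleted_enhanced_power_graph_iff
        by (metis DiffI nat_pow_0 nat_pow_closed singletonD)
    qed
    have triangle: "(a [^]\<^bsub>G\<^esub> (1::nat)) \<rightarrow>\<^bsub>?H\<^esub> (a [^]\<^bsub>G\<^esub> (2::nat))"
      "(a [^]\<^bsub>G\<^esub> (2::nat)) \<rightarrow>\<^bsub>?H\<^esub> (a [^]\<^bsub>G\<^esub> (3::nat))"
      "(a [^]\<^bsub>G\<^esub> (3::nat)) \<rightarrow>\<^bsub>?H\<^esub> (a [^]\<^bsub>G\<^esub> (1::nat))"
      by (rule edge; simp)+
    have "distinct [a [^]\<^bsub>G\<^esub> (1::nat), a [^]\<^bsub>G\<^esub> (2::nat), a [^]\<^bsub>G\<^esub> (3::nat)]"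
      using inj[of 1 2] inj[of 1 3] inj[of 2 3] by (simp del: nat_pow_eone nat_pow_Suc)
    with triangle show ?thesis
      by (intro conjI H.triangle_not_ugraph_acyclic triangle_not_bipartite)
  qed
  show ?thesis
    using small large H.ugraph_forest_iff_acyclic by (meson not_less)
qed

end
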